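(* Asymptotically almost surely, the treewidth of a graph drawn randomly from $G(n,\frac12)$ is $\Theta(n)$. That is, there exist constants $0<c\le C$ such that, for $G$ drawn from $G(n,\frac12)$, $$\lim_{n\to\infty}\Pr\big[c\,n\le \mathrm{tw}(G)\le C\,n\big]=1,$$ where $\mathrm{tw}(G)$ denotes the treewidth of $G$.
   Context: $G(n,\frac12)$ is the random simple graph on $n$ labelled vertices in which each of the $\binom n2$ possible edges appears independently with probability $\frac12$. Treewidth is the standard notion: a tree decomposition of $G=(V,E)$ is a tree $T$ with bags $B_t\subseteq V$ ($t\in V(T)$) such that every vertex lies in some bag, every edge of $G$ has both ends in some common bag, and for each $v\in V$ the nodes $t$ with $v\in B_t$ induce a connected subtree of $T$; its width is $\max_t|B_t|-1$, and $\mathrm{tw}(G)$ is the minimum width over all tree decompositions of $G$. *)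

theory Defs
  imports "HOL-Probability.Probability"
begin

section \<open>Finite simple graphs and trees\<close>

type_synonym 'a graph = "'a set \<times> 'a set set"

abbreviation verts :: "'a graph \<Rightarrow> 'a set" where "verts \<equiv> fst"
abbreviation edges :: "'a graph \<Rightarrow> 'a set set" where "edges \<equiv> snd"

definition all_edges :: "'a set \<Rightarrow> 'a set set" where
  "all_edges V = {e. e \<subseteq> V \<and> card e = 2}"

definition simple_graph :: "'a graph \<Rightarrow> bool" where
  "simple_graph G \<longleftrightarrow> finite (verts G) \<and> edges G \<subseteq> all_edges (verts G)"

definition induced :: "'a graph \<Rightarrow> 'a set \<Rightarrow> 'a graph" where
  "induced G S = (verts G \<inter> S, {e \<in> edges G. e \<subseteq> S})"

definition graph_connected :: "'a graph \<Rightarrow> bool" where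
  "graph_connected G \<longleftrightarrow> verts G \<noteq> {} \<and>
     (\<forall>u\<in>verts G. \<forall>v\<in>verts G. (\<lambda>x y. {x, y} \<in> edges G)\<^sup>*\<^sup>* u v)"

definition graph_cycle :: "'a graph \<Rightarrow> 'a list \<Rightarrow> bool" where
  "graph_cycle G xs \<longleftrightarrow> length xs \<ge> 3 \<and> distinct xs \<and>
     (\<forall>i<length xs. {xs ! i, xs ! (Suc i mod length xs)} \<in> edges G)"

definition is_tree :: "'a graph \<Rightarrow> bool" where
  "is_tree T \<longleftrightarrow> simple_graph T \<and> graph_connected T \<and> (\<nexists>xs. graph_cycle T xs)"


section \<open>Treewidth\<close>

definition tree_decomposition :: "'a graph \<Rightarrow> 't graph \<Rightarrow> ('t \<Rightarrow> 'a set) \<Rightarrow> bool" where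
  "tree_decomposition G T B \<longleftrightarrow>
     is_tree T \<and>
     (\<forall>t\<in>verts T. B t \<subseteq> verts G) \<and>
     (\<forall>v\<in>verts G. \<exists>t\<in>verts T. v \<in> B t) \<and>
     (\<forall>e\<in>edges G. \<exists>t\<in>verts T. e \<subseteq> B t) \<and>
     (\<forall>v\<in>verts G. graph_connected (induced T {t \<in> verts T. v \<in> B t}))"

text \<open>Integer-valued, so that the empty graph has treewidth \<open>-1\<close> rather than a truncated value.\<close>

definition td_width :: "'t graph \<Rightarrow> ('t \<Rightarrow> 'a set) \<Rightarrow> int" where
  "td_width T B = Max ((\<lambda>t. int (card (B t))) ` verts T) - 1"

text \<open>
  Decomposition trees are finite, so letting their nodes range over the natural numbers
  loses no generality.
\<close>

definition treewidth :: "'a graph \<Rightarrow> int" where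
  "treewidth G = (LEAST w. \<exists>(T :: nat graph) B. tree_decomposition G T B \<and> w = td_width T B)"


section \<open>The binomial random graph\<close>

definition random_graph :: "nat \<Rightarrow> real \<Rightarrow> nat graph pmf" where
  "random_graph n p =
     map_pmf (\<lambda>X. ({..<n}, {e \<in> all_edges {..<n}. X e}))
       (Pi_pmf (all_edges {..<n}) False (\<lambda>_. bernoulli_pmf p))"

end

theory Submission
  imports Defs "HOL-Real_Asymp.Real_Asymp"
begin

text \<open>
  The upper bound is deterministic: one bag holding all \<open>n\<close> vertices has width \<open>n - 1\<close>.

  The lower bound comes from the inequality between treewidth and minimum degree. Every tree
  decomposition of a nonempty graph has a bag that contains some vertex together with all its
  neighbours (\<open>ex_closed_neighbourhood_in_bag\<close>), so the width is at least the degree of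
  that vertex. In \<open>G(n, 1/2)\<close> a fixed vertex has a binomially distributed degree with mean
  \<open>(n - 1) / 2\<close>, and by Hoeffding's inequality the probability that the degree drops to
  \<open>(n - 1) / 4\<close> is at most \<open>exp (-(n - 1) / 8)\<close>
  (\<open>prob_low_degree\<close>). This is small enough to survive a union bound over the \<open>n\<close> vertices.
  Since \<open>(n - 1) / 4 \<ge> n / 8\<close> for \<open>n \<ge> 2\<close>, the constants \<open>c = 1/8\<close> and \<open>C = 1\<close> work.
\<close>

section \<open>Walks in forests\<close>

definition distinct_walk :: "'a graph \<Rightarrow> 'a list \<Rightarrow> bool" where
  "distinct_walk T xs \<longleftrightarrow>
     set xs \<subseteq> verts T \<and> distinct xs \<and> successively (\<lambda>x y. {x, y} \<in> edges T) xs"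

lemma simple_graph_edgeD:
  assumes "simple_graph T" "{x, y} \<in> edges T"
  shows "x \<noteq> y" "x \<in> verts T" "y \<in> verts T"
  using assms by (auto simp: simple_graph_def all_edges_def)

lemma distinct_walk_length_le:
  assumes "simple_graph T" "distinct_walk T xs"
  shows "length xs \<le> card (verts T)"
  using assms by (metis card_mono distinct_card distinct_walk_def simple_graph_def)

text \<open>
  Otherwise the part of the walk from the earlier vertex \<open>y\<close> onwards, closed by the new
  edge, would be a cycle. So in a forest a walk without immediate backtracking never revisits a
  vertex.
\<close>

lemma acyclic_walk_revisit_is_predecessor:
  assumes "\<nexists>ys. graph_cycle T ys"
    and walk: "distinct_walk T (xs @ [x])" and edge: "{x, y} \<in> edges T" and "y \<in> set xs"
  shows "last xs = y"
proof (rule ccontr)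
  assume "last xs \<noteq> y"
  obtain as bs where xs: "xs = as @ y # bs"
    using \<open>y \<in> set xs\<close> by (meson split_list)
  with \<open>last xs \<noteq> y\<close> have "bs \<noteq> []" by auto
  define cs where "cs = y # bs @ [x]"
  have "distinct cs" and succ: "successively (\<lambda>x y. {x, y} \<in> edges T) cs"
    using walk by (auto simp: distinct_walk_def xs cs_def successively_append_iff)
  moreover have "length cs \<ge> 3"
    using \<open>bs \<noteq> []\<close> by (cases bs) (auto simp: cs_def)
  moreover have "{cs ! i, cs ! (Suc i mod length cs)} \<in> edges T" if "i < length cs" for i
  proof (cases "Suc i < length cs")
    case True
    then show ?thesis using successively_nth[OF succ] by simp
  next
    case False
    with that have "Suc i = length cs" by simp
    moreover from this have "cs ! i = x" by (simp add: cs_def nth_append)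
    ultimately show ?thesis using edge by (simp add: cs_def)
  qed
  ultimately have "graph_cycle T cs" by (simp add: graph_cycle_def)
  with assms(1) show False by blast
qed

section \<open>Treewidth is at least the minimum degree\<close>

text \<open>
  On a one-node walk the whole bag counts as new. This makes such walks eligible for the
  maximality argument below, which therefore also covers decompositions whose bags are all equal.
\<close>

definition new_at_end :: "('t \<Rightarrow> 'a set) \<Rightarrow> 't list \<Rightarrow> 'a set" where
  "new_at_end B ws = B (last ws) - (if butlast ws = [] then {} else B (last (butlast ws)))"

text \<open>
  Take a longest walk whose last bag \<open>B t\<close> contains a vertex \<open>v\<close> absent from the bag before
  it. Maximality means that bags can only shrink when the walk is continued, and the nodes of
  \<open>v\<close> can only be reached from \<open>t\<close> by continuing the walk, because the preceding node
  is not one of them. Hence all bags containing \<open>v\<close> lie inside \<open>B t\<close>, and with them all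
  neighbours of \<open>v\<close>.
\<close>

lemma ex_closed_neighbourhood_in_bag:
  assumes td: "tree_decomposition G T B" and ne: "verts G \<noteq> {}"
  shows "\<exists>v\<in>verts G. \<exists>t\<in>verts T. v \<in> B t \<and> (\<forall>u. {u, v} \<in> edges G \<longrightarrow> u \<in> B t)"
proof -
  have simple: "simple_graph T" and acyclic: "\<nexists>ys. graph_cycle T ys"
    using td by (auto simp: tree_decomposition_def is_tree_def)
  let ?P = "\<lambda>ws. ws \<noteq> [] \<and> distinct_walk T ws \<and> new_at_end B ws \<noteq> {}"
  obtain v0 t0 where "t0 \<in> verts T" "v0 \<in> B t0"
    using td ne unfolding tree_decomposition_def by blast
  then have "?P [t0]" by (auto simp: distinct_walk_def new_at_end_def)
  moreover have "\<forall>ws. ?P ws \<longrightarrow> length ws < Suc (card (verts T))"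
    using distinct_walk_length_le[OF simple] by (auto simp: less_Suc_eq_le)
  ultimately obtain ws where ws: "?P ws" and longest: "\<And>xs. ?P xs \<Longrightarrow> length xs \<le> length ws"
    using ex_has_greatest_nat[of ?P "[t0]" length "Suc (card (verts T))"] by blast
  define t where "t = last ws"
  from ws obtain v where v: "v \<in> new_at_end B ws" by blast
  have vt: "v \<in> B t" using v by (simp add: new_at_end_def t_def)
  have tT: "t \<in> verts T"
    using ws by (metis distinct_walk_def last_in_set subsetD t_def)
  have vG: "v \<in> verts G" using td tT vt by (auto simp: tree_decomposition_def)
  let ?S = "induced T {t \<in> verts T. v \<in> B t}"
  have continue: "\<exists>zs. distinct_walk T (ws @ zs) \<and> last (ws @ zs) = s \<and> (\<forall>z\<in>set zs. B z \<subseteq> B t)"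
    if "(\<lambda>x y. {x, y} \<in> edges ?S)\<^sup>*\<^sup>* t s" for s
    using that
  proof (induction rule: rtranclp_induct)
    case base
    show ?case using ws by (intro exI[of _ "[]"]) (simp add: t_def)
  next
    case (step s s')
    then obtain zs where zs: "distinct_walk T (ws @ zs)" "last (ws @ zs) = s"
      "\<forall>z\<in>set zs. B z \<subseteq> B t" by blast
    have edge: "{s, s'} \<in> edges T" and vs': "v \<in> B s'"
      using step.hyps by (auto simp: induced_def)
    note ss' = simple_graph_edgeD[OF simple edge]
    define xs where "xs = butlast (ws @ zs)"
    have xs: "ws @ zs = xs @ [s]"
      using ws zs(2) by (metis append_butlast_last_id append_is_Nil_conv xs_def)
    show ?case
    proof (cases "s' \<in> set (ws @ zs)")
      case True
      then have "s' \<in> set xs" using ss'(1) xs by auto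
      then have last: "last xs = s'"
        using acyclic_walk_revisit_is_predecessor[OF acyclic _ edge] zs(1) xs by simp
      \<comment> \<open>Stepping back from \<open>t\<close> itself would lead to the node before it, whose bag lacks \<open>v\<close>.\<close>
      have "zs \<noteq> []"
      proof
        assume "zs = []"
        then have "v \<notin> B s'"
          using v last \<open>s' \<in> set xs\<close> by (auto simp: new_at_end_def xs_def split: if_splits)
        with vs' show False by blast
      qed
      then have xs': "xs = ws @ butlast zs" by (simp add: xs_def butlast_append)
      have "distinct_walk T xs"
        using zs(1) unfolding xs by (auto simp: distinct_walk_def successively_append_iff)
      then show ?thesis
        using last zs(3) xs' by (intro exI[of _ "butlast zs"]) (auto dest: in_set_butlastD)
    next
      case False
      let ?ws' = "ws @ zs @ [s']"
      have walk: "distinct_walk T ?ws'"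
        using zs False edge ss' ws unfolding distinct_walk_def append_assoc[symmetric]
        by (subst successively_append_iff) auto
      moreover have "?ws' \<noteq> []" "\<not> length ?ws' \<le> length ws" by auto
      ultimately have "new_at_end B ?ws' = {}" using longest by blast
      then have "B s' \<subseteq> B s"
        using zs(2) ws unfolding new_at_end_def append_assoc[symmetric] butlast_snoc last_snoc
        by (auto split: if_splits)
      moreover have "B s \<subseteq> B t"
        using zs(2,3) by (cases "zs = []") (auto simp: t_def)
      ultimately show ?thesis
        using walk zs(3) by (intro exI[of _ "zs @ [s']"]) auto
    qed
  qed
  have "u \<in> B t" if "{u, v} \<in> edges G" for u
  proof -
    have "\<forall>e\<in>edges G. \<exists>s\<in>verts T. e \<subseteq> B s"
      using td by (simp add: tree_decomposition_def)
    with that obtain s where s: "s \<in> verts T" "{u, v} \<subseteq> B s"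
      by meson
    have "(\<lambda>x y. {x, y} \<in> edges ?S)\<^sup>*\<^sup>* t s"
    proof -
      have "graph_connected ?S" using td vG by (simp add: tree_decomposition_def)
      moreover have "t \<in> verts ?S" "s \<in> verts ?S" using tT vt s by (simp_all add: induced_def)
      ultimately show ?thesis unfolding graph_connected_def by blast
    qed
    then obtain zs where "last (ws @ zs) = s" "\<forall>z\<in>set zs. B z \<subseteq> B t"
      using continue by blast
    then have "B s \<subseteq> B t" by (cases "zs = []") (auto simp: t_def)
    with s show ?thesis by auto
  qed
  with vG tT vt show ?thesis by blast
qed

lemma card_bag_le_td_width:
  assumes "tree_decomposition G T B" "t \<in> verts T"
  shows "int (card (B t)) - 1 \<le> td_width T B"
proof -
  have "finite (verts T)"
    using assms(1) by (simp add: tree_decomposition_def is_tree_def simple_graph_def)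
  then have "int (card (B t)) \<le> Max ((\<lambda>t. int (card (B t))) ` verts T)"
    using assms(2) by (intro Max_ge) auto
  then show ?thesis by (simp add: td_width_def)
qed

lemma min_degree_le_td_width:
  assumes G: "simple_graph G" "verts G \<noteq> {}" and td: "tree_decomposition G T B"
    and deg: "\<And>v. v \<in> verts G \<Longrightarrow> d \<le> int (card {e \<in> edges G. v \<in> e})"
  shows "d \<le> td_width T B"
proof -
  obtain v t where v: "v \<in> verts G" "t \<in> verts T" "v \<in> B t"
    and nbrs: "\<And>u. {u, v} \<in> edges G \<Longrightarrow> u \<in> B t"
    using ex_closed_neighbourhood_in_bag[OF td G(2)] by blast
  have fin: "finite (B t)"
    using td v(2) G(1) by (auto simp: tree_decomposition_def simple_graph_def intro: finite_subset)
  have "{e \<in> edges G. v \<in> e} \<subseteq> (\<lambda>u. {u, v}) ` (B t - {v})"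
  proof
    fix e assume e: "e \<in> {e \<in> edges G. v \<in> e}"
    then have "card e = 2" using G(1) by (auto simp: simple_graph_def all_edges_def)
    then obtain u where "e = {u, v}" "u \<noteq> v"
      using e by (auto simp: card_2_iff)
    then show "e \<in> (\<lambda>u. {u, v}) ` (B t - {v})" using nbrs e by auto
  qed
  then have "card {e \<in> edges G. v \<in> e} \<le> card (B t - {v})"
    using fin by (meson card_image_le card_mono finite_Diff finite_imageI le_trans)
  also have "\<dots> = card (B t) - 1" using v(3) by simp
  finally have "int (card {e \<in> edges G. v \<in> e}) \<le> int (card (B t)) - 1"
    using v(3) fin by (cases "card (B t)") auto
  with deg[OF v(1)] card_bag_le_td_width[OF td v(2)] show ?thesis by linarith
qed

lemma single_bag_decomposition:
  assumes "simple_graph G"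
  shows "tree_decomposition G ({0 :: nat}, {}) (\<lambda>_. verts G)"
proof -
  have "\<not> graph_cycle ({0 :: nat}, {}) xs" for xs
    by (cases xs) (auto simp: graph_cycle_def)
  then have "is_tree ({0 :: nat}, {})"
    by (simp add: is_tree_def simple_graph_def graph_connected_def)
  then show ?thesis
    using assms
    by (auto simp: tree_decomposition_def simple_graph_def all_edges_def graph_connected_def
          induced_def)
qed

text \<open>
  The integers are not well-ordered, but widths are at least \<open>-1\<close>, so increasing them by one
  turns them into natural numbers, among which there is a least one.
\<close>

lemma treewidth_attained:
  assumes "simple_graph G"
  shows "\<exists>(T :: nat graph) B. tree_decomposition G T B \<and> treewidth G = td_width T B"
    and "tree_decomposition G (T :: nat graph) B \<Longrightarrow> treewidth G \<le> td_width T B"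
proof -
  let ?P = "\<lambda>w. \<exists>(T :: nat graph) B. tree_decomposition G T B \<and> w = td_width T B"
  have lower: "-1 \<le> w" if "?P w" for w
  proof -
    from that obtain T :: "nat graph" and B where td: "tree_decomposition G T B" "w = td_width T B"
      by blast
    then obtain t where "t \<in> verts T"
      by (auto simp: tree_decomposition_def is_tree_def graph_connected_def)
    with card_bag_le_td_width[OF td(1)] td(2) show ?thesis by fastforce
  qed
  have "?P (td_width ({0 :: nat}, {}) (\<lambda>_. verts G))"
    using single_bag_decomposition[OF assms] by blast
  then obtain w where w: "?P w" and least: "\<And>x. ?P x \<Longrightarrow> nat (w + 1) \<le> nat (x + 1)"
    using ex_has_least_nat[of ?P _ "\<lambda>w. nat (w + 1)"] by blast
  have least': "w \<le> x" if "?P x" for x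
    using least[OF that] lower[OF that] lower[OF w] by linarith
  have eq: "treewidth G = w"
    unfolding treewidth_def by (rule Least_equality) (use w least' in blast)+
  show "?P (treewidth G)" using w eq by simp
  show "tree_decomposition G (T :: nat graph) B \<Longrightarrow> treewidth G \<le> td_width T B"
    using least' eq by blast
qed

lemma treewidth_ge_min_degree:
  assumes "simple_graph G" "verts G \<noteq> {}"
    and "\<And>v. v \<in> verts G \<Longrightarrow> d \<le> int (card {e \<in> edges G. v \<in> e})"
  shows "d \<le> treewidth G"
  using treewidth_attained(1)[OF assms(1)] min_degree_le_td_width[OF assms(1,2) _ assms(3)]
  by metis

lemma treewidth_less_card:
  assumes "simple_graph G"
  shows "treewidth G \<le> int (card (verts G)) - 1"
  using treewidth_attained(2)[OF assms single_bag_decomposition[OF assms]]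
  by (simp add: td_width_def)

section \<open>Degrees in the random graph\<close>

lemma random_graph_simple:
  assumes "G \<in> set_pmf (random_graph n p)"
  shows "simple_graph G" "verts G = {..<n}"
  using assms by (auto simp: random_graph_def simple_graph_def)

lemma finite_all_edges: "finite V \<Longrightarrow> finite (all_edges V)"
  by (auto simp: all_edges_def)

lemma card_all_edges_at:
  assumes "finite V" "v \<in> V"
  shows "card {e \<in> all_edges V. v \<in> e} = card V - 1"
proof -
  have "{e \<in> all_edges V. v \<in> e} = (\<lambda>u. {u, v}) ` (V - {v})"
    using assms(2) by (auto simp: all_edges_def card_2_iff)
  moreover have "inj_on (\<lambda>u. {u, v}) (V - {v})"
    by (auto simp: inj_on_def doubleton_eq_iff)
  ultimately show ?thesis using assms by (simp add: card_image)
qed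

text \<open>
  The \<open>n - 1\<close> indicators of the potential edges at \<open>v\<close> form a subfamily of the independent
  family that defines the random graph, and the degree of \<open>v\<close> is their sum.
\<close>

lemma degree_distribution:
  assumes "v < n" "p \<in> {0..1}"
  shows "map_pmf (\<lambda>G. card {e \<in> edges G. v \<in> e}) (random_graph n p) = binomial_pmf (n - 1) p"
proof -
  let ?A = "all_edges {..<n}" and ?I = "{e \<in> all_edges {..<n}. v \<in> e}"
  have fin: "finite ?A" by (simp add: finite_all_edges)
  have "binomial_pmf (n - 1) p =
      map_pmf (\<lambda>f. card {e \<in> ?I. f e}) (Pi_pmf ?I False (\<lambda>_. bernoulli_pmf p))"
    using assms fin card_all_edges_at[of "{..<n}" v] by (intro binomial_pmf_altdef') auto
  also have "Pi_pmf ?I False (\<lambda>_. bernoulli_pmf p) =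
      map_pmf (\<lambda>f e. if e \<in> ?I then f e else False) (Pi_pmf ?A False (\<lambda>_. bernoulli_pmf p))"
    by (rule Pi_pmf_subset) (use fin in auto)
  finally show ?thesis
    by (auto simp: random_graph_def pmf.map_comp o_def intro!: map_pmf_cong arg_cong[of _ _ card])
qed

lemma prob_low_degree:
  assumes "v < n" "2 \<le> n"
  shows "measure_pmf.prob (random_graph n (1 / 2))
           {G. real (card {e \<in> edges G. v \<in> e}) \<le> (real n - 1) / 4} \<le> exp (- (real n - 1) / 8)"
proof -
  interpret binomial_distribution "n - 1" "1 / 2" by unfold_locales simp
  have "measure_pmf.prob (random_graph n (1 / 2))
           {G. real (card {e \<in> edges G. v \<in> e}) \<le> (real n - 1) / 4} =
        measure_pmf.prob (binomial_pmf (n - 1) (1 / 2)) {x. real x \<le> (real n - 1) / 4}"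
    by (subst degree_distribution[OF assms(1), symmetric]) (auto simp: vimage_def)
  also have "{x. real x \<le> (real n - 1) / 4} =
      {x. real x \<le> real (n - 1) * (1 / 2) - (real n - 1) / 4}"
    using assms by (auto simp: of_nat_diff field_simps)
  also have "measure_pmf.prob (binomial_pmf (n - 1) (1 / 2)) \<dots> \<le>
      exp (- 2 * ((real n - 1) / 4)\<^sup>2 / real (n - 1))"
    by (rule prob_le) (use assms in auto)
  also have "- 2 * ((real n - 1) / 4)\<^sup>2 / real (n - 1) = - (real n - 1) / 8"
    using assms by (simp add: of_nat_diff power2_eq_square field_simps)
  finally show ?thesis .
qed

text \<open>
  If no vertex has low degree, the minimum degree bounds the treewidth from below; the
  exceptional event is a union of \<open>n\<close> events of exponentially small probability.
\<close>

lemma prob_treewidth_linear: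
  assumes "2 \<le> n"
  shows "1 - real n * exp (- (real n - 1) / 8) \<le>
    measure_pmf.prob (random_graph n (1 / 2))
      {G. 1 / 8 * real n \<le> real_of_int (treewidth G) \<and> real_of_int (treewidth G) \<le> 1 * real n}"
    (is "_ \<le> measure_pmf.prob ?M ?good")
proof -
  let ?low = "\<lambda>v. {G. real (card {e \<in> edges G. v \<in> e}) \<le> (real n - 1) / 4}"
  have bad: "G \<in> (\<Union>v\<in>{..<n}. ?low v)" if G: "G \<in> set_pmf ?M" and "G \<notin> ?good" for G
  proof (rule ccontr)
    assume high: "G \<notin> (\<Union>v\<in>{..<n}. ?low v)"
    note simple = random_graph_simple[OF G]
    have "\<lceil>(real n - 1) / 4\<rceil> \<le> int (card {e \<in> edges G. v \<in> e})" if "v \<in> verts G" for v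
      using high that simple(2) by (force simp: ceiling_le_iff not_le)
    then have "\<lceil>(real n - 1) / 4\<rceil> \<le> treewidth G"
      using simple assms by (intro treewidth_ge_min_degree) (auto simp: lessThan_empty_iff)
    then have "1 / 8 * real n \<le> real_of_int (treewidth G)"
      using assms by (simp add: ceiling_le_iff)
    moreover have "treewidth G \<le> int n"
      using treewidth_less_card[OF simple(1)] simple(2) by simp
    ultimately show False using \<open>G \<notin> ?good\<close> by auto
  qed
  have "1 - measure_pmf.prob ?M ?good = measure_pmf.prob ?M (- ?good)"
    by (subst measure_pmf.prob_compl[symmetric]) (auto simp: Compl_eq_Diff_UNIV)
  also have "\<dots> \<le> measure_pmf.prob ?M (\<Union>v\<in>{..<n}. ?low v)"
    by (rule measure_pmf.finite_measure_mono_AE) (use bad in \<open>auto simp: AE_measure_pmf_iff\<close>)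
  also have "\<dots> \<le> (\<Sum>v<n. measure_pmf.prob ?M (?low v))"
    by (rule measure_pmf.finite_measure_subadditive_finite) auto
  also have "\<dots> \<le> (\<Sum>v<n. exp (- (real n - 1) / 8))"
    by (rule sum_mono) (use assms prob_low_degree in auto)
  finally show ?thesis by simp
qed

theorem corollary2:
  shows "\<exists>c C :: real. 0 < c \<and> c \<le> C \<and>
    (\<lambda>n. measure_pmf.prob (random_graph n (1 / 2))
           {G. c * real n \<le> real_of_int (treewidth G) \<and>
               real_of_int (treewidth G) \<le> C * real n}) \<longlonglongrightarrow> 1"
proof (intro exI conjI)
  show "(\<lambda>n. measure_pmf.prob (random_graph n (1 / 2))
           {G. 1 / 8 * real n \<le> real_of_int (treewidth G) \<and>
               real_of_int (treewidth G) \<le> 1 * real n}) \<longlonglongrightarrow> 1"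
  proof (rule tendsto_sandwich[OF _ _ _ tendsto_const])
    show "(\<lambda>n. 1 - real n * exp (- (real n - 1) / 8)) \<longlonglongrightarrow> 1"
      by real_asymp
  qed (use prob_treewidth_linear in \<open>auto simp: eventually_sequentially\<close>)
qed simp_all

end
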